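(* Let $A_1,A_2\in\mathbf{C}^{n\times n}$, $B_1,B_2\in\mathbf{C}^{n\times m}$, let $\mathit{\Gamma}$ be a desired eigenvalue set ($2n$ complex numbers, counted with multiplicity) that is symmetric with respect to the real axis, and let $F\in\mathbf{R}^{2n\times 2n}$ be a real matrix such that $\lambda(F)=\mathit{\Gamma}$ (such an $F$ exists because $\mathit{\Gamma}$ is symmetric with respect to the real axis). The pole assignment problem is: find a bimatrix $\{K_1,K_2\}\in\{\mathbf{C}^{m\times n},\mathbf{C}^{m\times n}\}$ such that the closed-loop system $$x^+=\left(\{A_1,A_2\}+\{B_1,B_2\}\{K_1,K_2\}\right)x$$ possesses the eigenvalue set $\mathit{\Gamma}$. The pole assignment problem is solvable if and only if there exists a nonsingular bimatrix $\{X_1,X_2\}\in\{\mathbf{C}^{n\times n},\mathbf{C}^{n\times n}\}$ satisfying (together with some bimatrix $\{Y_1,Y_2\}\in\{\mathbf{C}^{m\times n},\mathbf{C}^{m\times n}\}$) the generalized Sylvester bimatrix equation $$\{A_1,A_2\}\{X_1,X_2\}+\{B_1,B_2\}\{Y_1,Y_2\}=\{X_1,X_2\}\{F_1,F_2\},$$ where $\{F_1,F_2\}\in\{\mathbf{C}^{n\times n},\mathbf{C}^{n\times n}\}$ is the unique bimatrix satisfying $F=\{F_1,F_2\}_\circ$. In this case, the feedback gain bimatrix $\{K_1,K_2\}$ is determined by $$\{K_1,K_2\}=\{Y_1,Y_2\}\{X_1,X_2\}^{-1}.$$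
   Context: $A^{\#}$ denotes the entrywise complex conjugate of $A$, and $\lambda(F)$ is the eigenvalue set of $F$. A bimatrix $\{A_1,A_2\}\in\{\mathbf{C}^{n\times m},\mathbf{C}^{n\times m}\}$ is a pair of matrices of the same size, identified with the real-linear map $\mathbf{C}^m\to\mathbf{C}^n$, $x\mapsto\{A_1,A_2\}x=A_1x+A_2^{\#}x^{\#}$. Addition is componentwise, and the product corresponds to composition: $\{A_1,A_2\}\{X_1,X_2\}=\{A_1X_1+A_2^{\#}X_2,\;A_1^{\#}X_2+A_2X_1\}$. The identity is $\{I_n,0_{n\times n}\}$; a square bimatrix is nonsingular if it has an inverse for this product. The real representation is $$\{P_1,P_2\}_\circ=\begin{bmatrix}\mathrm{Re}(P_1+P_2)&-\mathrm{Im}(P_1+P_2)\\ \mathrm{Im}(P_1-P_2)&\mathrm{Re}(P_1-P_2)\end{bmatrix}\in\mathbf{R}^{2n\times 2m},$$ and the eigenvalues of a square bimatrix are those of its real representation (equivalently of its complex lifting $\begin{bmatrix}P_1&P_2^{\#}\\P_2&P_1^{\#}\end{bmatrix}$). The setting is the complex-valued linear system $x^+=\{A_1,A_2\}x+\{B_1,B_2\}u$ with full state feedback $u=\{K_1,K_2\}x$, where $x^+$ denotes $\dot x(t)$ (continuous time) or $x(t+1)$ (discrete time).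
   Formalization: The "only if" part fails for a fixed F when Γ has repeated elements; solvability is shown equivalent to a nonsingular solution for some F with λ(F)=Γ, and for each fixed F if Γ has none. For any fixed F, the gains YX⁻¹ are those making the closed loop similar to F. *)

theory Defs
  imports
    "Jordan_Normal_Form.Char_Poly"
    "HOL-Computational_Algebra.Fundamental_Theorem_Algebra"
begin

type_synonym bimat = "complex mat \<times> complex mat"

definition carrier_bimat :: "nat \<Rightarrow> nat \<Rightarrow> bimat set" where
  "carrier_bimat r c = carrier_mat r c \<times> carrier_mat r c"

abbreviation mat_cnj :: "complex mat \<Rightarrow> complex mat" where
  "mat_cnj \<equiv> map_mat cnj"

definition bimat_apply :: "bimat \<Rightarrow> complex vec \<Rightarrow> complex vec" where
  "bimat_apply P x = fst P *\<^sub>v x + mat_cnj (snd P) *\<^sub>v map_vec cnj x"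

definition bimat_add :: "bimat \<Rightarrow> bimat \<Rightarrow> bimat" where
  "bimat_add P Q = (fst P + fst Q, snd P + snd Q)"

definition bimat_mult :: "bimat \<Rightarrow> bimat \<Rightarrow> bimat" where
  "bimat_mult P Q =
     (fst P * fst Q + mat_cnj (snd P) * snd Q,
      mat_cnj (fst P) * snd Q + snd P * fst Q)"

definition bimat_one :: "nat \<Rightarrow> bimat" where
  "bimat_one n = (1\<^sub>m n, 0\<^sub>m n n)"

definition is_bimat_inv :: "nat \<Rightarrow> bimat \<Rightarrow> bimat \<Rightarrow> bool" where
  "is_bimat_inv n X Z \<longleftrightarrow> Z \<in> carrier_bimat n n \<and>
     bimat_mult X Z = bimat_one n \<and> bimat_mult Z X = bimat_one n"

definition nonsingular_bimat :: "nat \<Rightarrow> bimat \<Rightarrow> bool" where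
  "nonsingular_bimat n X \<longleftrightarrow> X \<in> carrier_bimat n n \<and> (\<exists>Z. is_bimat_inv n X Z)"

text \<open>Meaningful only for nonsingular \<open>X\<close>, where the inverse is unique.\<close>

definition bimat_inv :: "nat \<Rightarrow> bimat \<Rightarrow> bimat" where
  "bimat_inv n X = (THE Z. is_bimat_inv n X Z)"

definition real_rep :: "bimat \<Rightarrow> real mat" where
  "real_rep P = four_block_mat
     (map_mat Re (fst P + snd P)) (- map_mat Im (fst P + snd P))
     (map_mat Im (fst P - snd P)) (map_mat Re (fst P - snd P))"

text \<open>Well defined on real \<open>2n \<times> 2n\<close> matrices, see \<open>ex1_real_rep\<close> below.\<close>

definition bimat_of_real :: "nat \<Rightarrow> real mat \<Rightarrow> bimat" where
  "bimat_of_real n F = (THE P. P \<in> carrier_bimat n n \<and> real_rep P = F)"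

text \<open>Complex eigenvalues of a real square matrix, with algebraic multiplicity.\<close>

definition eigvals_real :: "real mat \<Rightarrow> complex multiset" where
  "eigvals_real F = proots (char_poly (map_mat complex_of_real F))"

definition bimat_eigvals :: "bimat \<Rightarrow> complex multiset" where
  "bimat_eigvals P = eigvals_real (real_rep P)"

definition closed_loop :: "bimat \<Rightarrow> bimat \<Rightarrow> bimat \<Rightarrow> bimat" where
  "closed_loop A B K = bimat_add A (bimat_mult B K)"

definition solves_pole_assignment ::
  "nat \<Rightarrow> nat \<Rightarrow> bimat \<Rightarrow> bimat \<Rightarrow> complex multiset \<Rightarrow> bimat \<Rightarrow> bool" where
  "solves_pole_assignment n m A B \<Gamma> K \<longleftrightarrow>
     K \<in> carrier_bimat m n \<and> bimat_eigvals (closed_loop A B K) = \<Gamma>"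

definition pole_assignment_solvable ::
  "nat \<Rightarrow> nat \<Rightarrow> bimat \<Rightarrow> bimat \<Rightarrow> complex multiset \<Rightarrow> bool" where
  "pole_assignment_solvable n m A B \<Gamma> \<longleftrightarrow> (\<exists>K. solves_pole_assignment n m A B \<Gamma> K)"

definition nonsingular_sylvester_solution ::
  "nat \<Rightarrow> nat \<Rightarrow> bimat \<Rightarrow> bimat \<Rightarrow> real mat \<Rightarrow> bimat \<Rightarrow> bimat \<Rightarrow> bool" where
  "nonsingular_sylvester_solution n m A B F X Y \<longleftrightarrow>
     nonsingular_bimat n X \<and> Y \<in> carrier_bimat m n \<and>
     bimat_add (bimat_mult A X) (bimat_mult B Y) = bimat_mult X (bimat_of_real n F)"

lemma ex1_real_rep:
  assumes F: "F \<in> carrier_mat (2 * n) (2 * n)"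
  shows "\<exists>!P. P \<in> carrier_bimat n n \<and> real_rep P = F"
proof (rule ex_ex1I)
  define P1 where "P1 = mat n n (\<lambda>(i,j). Complex ((F $$ (i,j) + F $$ (i+n,j+n)) / 2)
                                                 ((F $$ (i+n,j) - F $$ (i,j+n)) / 2))"
  define P2 where "P2 = mat n n (\<lambda>(i,j). Complex ((F $$ (i,j) - F $$ (i+n,j+n)) / 2)
                                                 (- (F $$ (i,j+n) + F $$ (i+n,j)) / 2))"
  have "real_rep (P1, P2) = F"
    by (rule eq_matI)
       (use F in \<open>auto simp: real_rep_def P1_def P2_def field_simps\<close>)
  moreover have "(P1, P2) \<in> carrier_bimat n n"
    by (auto simp: carrier_bimat_def P1_def P2_def)
  ultimately show "\<exists>P. P \<in> carrier_bimat n n \<and> real_rep P = F" by blast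
next
  fix P Q
  assume PQ: "P \<in> carrier_bimat n n \<and> real_rep P = F" "Q \<in> carrier_bimat n n \<and> real_rep Q = F"
  have entries: "real_rep R $$ (i,j) = Re (fst R $$ (i,j)) + Re (snd R $$ (i,j))"
    "real_rep R $$ (i,j+n) = - Im (fst R $$ (i,j)) - Im (snd R $$ (i,j))"
    "real_rep R $$ (i+n,j) = Im (fst R $$ (i,j)) - Im (snd R $$ (i,j))"
    "real_rep R $$ (i+n,j+n) = Re (fst R $$ (i,j)) - Re (snd R $$ (i,j))"
    if "R \<in> carrier_bimat n n" "i < n" "j < n" for R i j
    using that by (auto simp: real_rep_def carrier_bimat_def)
  have ent: "fst P $$ (i,j) = fst Q $$ (i,j) \<and> snd P $$ (i,j) = snd Q $$ (i,j)"
    if "i < n" "j < n" for i j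
  proof -
    have P: "P \<in> carrier_bimat n n" and Q: "Q \<in> carrier_bimat n n"
      and eq: "real_rep P = real_rep Q" using PQ by auto
    show ?thesis
      using entries[OF P that] entries[OF Q that] unfolding eq complex_eq_iff by linarith
  qed
  show "P = Q"
    using PQ ent by (auto simp: carrier_bimat_def prod_eq_iff intro!: eq_matI)
qed

lemma bimat_apply_mult:
  assumes "P \<in> carrier_bimat r k" "Q \<in> carrier_bimat k c" "x \<in> carrier_vec c"
  shows "bimat_apply (bimat_mult P Q) x = bimat_apply P (bimat_apply Q x)"
proof (rule eq_vecI)
  fix i assume "i < dim_vec (bimat_apply P (bimat_apply Q x))"
  then have i: "i < r" using assms by (auto simp: bimat_apply_def carrier_bimat_def)
  obtain P1 P2 Q1 Q2 where PQ: "P = (P1,P2)" "Q = (Q1,Q2)" by (metis surj_pair)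
  have c: "P1 \<in> carrier_mat r k" "P2 \<in> carrier_mat r k"
    "Q1 \<in> carrier_mat k c" "Q2 \<in> carrier_mat k c"
    using assms PQ by (auto simp: carrier_bimat_def)
  have cnj_mv: "map_vec cnj (M *\<^sub>v y) = mat_cnj M *\<^sub>v map_vec cnj y"
    if "M \<in> carrier_mat a b" "y \<in> carrier_vec b" for M y and a b :: nat
    using that by (auto intro!: eq_vecI simp: scalar_prod_def)
  have cnj_add: "map_vec cnj (v + w) = map_vec cnj v + map_vec cnj w"
    if "v \<in> carrier_vec k" "w \<in> carrier_vec k" for v w
    using that by (auto intro!: eq_vecI)
  have cc: "mat_cnj (mat_cnj M) = M" "map_vec cnj (map_vec cnj x) = x" for M
    by (auto intro!: eq_matI eq_vecI)
  have cm: "mat_cnj (mat_cnj P1 * Q2 + P2 * Q1) = P1 * mat_cnj Q2 + mat_cnj P2 * mat_cnj Q1"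
    using c by (auto intro!: eq_matI simp: scalar_prod_def)
  have cl: "mat_cnj Q1 \<in> carrier_mat k c" "mat_cnj Q2 \<in> carrier_mat k c"
    "mat_cnj P2 \<in> carrier_mat r k" "map_vec cnj x \<in> carrier_vec c"
    using c assms by auto
  have "bimat_apply P (bimat_apply Q x) =
     P1 *\<^sub>v (Q1 *\<^sub>v x + mat_cnj Q2 *\<^sub>v map_vec cnj x) +
     mat_cnj P2 *\<^sub>v (mat_cnj Q1 *\<^sub>v map_vec cnj x + Q2 *\<^sub>v x)"
    using c cl assms(3)
    by (simp add: bimat_apply_def PQ cnj_add cnj_mv[of _ k c] cc)
  also have "\<dots> = (P1 * Q1 *\<^sub>v x + P1 * mat_cnj Q2 *\<^sub>v map_vec cnj x) +
     (mat_cnj P2 * mat_cnj Q1 *\<^sub>v map_vec cnj x + mat_cnj P2 * Q2 *\<^sub>v x)"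
    using c cl assms(3)
    by (simp add: mult_add_distrib_mat_vec[of _ r k] assoc_mult_mat_vec[of _ r k _ c])
  also have "\<dots> = bimat_apply (bimat_mult P Q) x"
    using c cl assms(3)
    unfolding bimat_apply_def bimat_mult_def PQ fst_conv snd_conv cm
    by (subst (1 2) add_mult_distrib_mat_vec[of _ r c]) (auto intro!: eq_vecI)
  finally show "bimat_apply (bimat_mult P Q) x $ i = bimat_apply P (bimat_apply Q x) $ i" by simp
qed (use assms in \<open>auto simp: bimat_apply_def bimat_mult_def carrier_bimat_def\<close>)

end

(* The real representation is an injective ring homomorphism onto the real 2n x 2n matrices, so
   eliminating Y = K X turns the Sylvester equation with nonsingular X into the similarity of the
   closed-loop matrix to F. Every solution therefore has the spectrum of F, and conversely F may be
   taken to be the closed-loop matrix itself. For a prescribed F the spectrum determines the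
   similarity class only when it is simple: then both matrices are diagonalizable over the complex
   numbers, and an invertible complex intertwiner R + iS of real matrices yields an invertible real
   one R + tS, because det (R + zS) is a nonzero polynomial in z. A conjugation-symmetric spectrum
   is realized by a block-diagonal matrix with 1 x 1 blocks and 2 x 2 rotation-scaling blocks. *)

theory Submission
  imports Defs "Jordan_Normal_Form.Schur_Decomposition"
begin


section \<open>Similarity over a field, and its descent from the complex to the real numbers\<close>

lemma similar_matI_intertwiner:
  fixes A :: "'a :: field mat"
  assumes A: "A \<in> carrier_mat N N" and F: "F \<in> carrier_mat N N" and P: "P \<in> carrier_mat N N"
    and det: "det P \<noteq> 0" and AP: "A * P = P * F"
  shows "similar_mat A F"
proof -
  from det_non_zero_imp_unit[OF P det, unfolded Units_def, of "()"]
  obtain Q where Q: "Q \<in> carrier_mat N N" "Q * P = 1\<^sub>m N" "P * Q = 1\<^sub>m N"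
    by (auto simp: ring_mat_def)
  have "P * F * Q = A * (P * Q)"
    unfolding AP[symmetric] using A P Q by (intro assoc_mult_mat)
  then have "A = P * F * Q" using A Q by simp
  then show ?thesis using A F P Q by (intro similar_matI[of _ _ P Q N]) auto
qed

text \<open>The matrix V with eigenvectors as columns satisfies A V = V D for the diagonal matrix D
  of the values \<open>f i\<close>. What needs work is the invertibility of V, that is, the linear
  independence of eigenvectors for distinct eigenvalues.\<close>

lemma similar_mat_diag_of_distinct_eigenvalues:
  fixes A :: "'a :: field mat"
  assumes A: "A \<in> carrier_mat N N"
    and inj: "inj_on f {..<N}" and ev: "\<And>i. i < N \<Longrightarrow> eigenvalue A (f i)"
  shows "similar_mat A (mat_diag N f)"
proof -
  obtain v where v: "eigenvector A (v i) (f i)" if "i < N" for i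
    using ev unfolding eigenvalue_def by metis
  have vc: "v i \<in> carrier_vec N" and v0: "v i \<noteq> 0\<^sub>v N" and Av: "A *\<^sub>v v i = f i \<cdot>\<^sub>v v i" if "i < N" for i
    using v[OF that] A by (auto simp: eigenvector_def)
  define V where "V = mat N N (\<lambda>(i,j). v j $ i)"
  have V: "V \<in> carrier_mat N N" by (simp add: V_def)
  have colV: "col V j = v j" if "j < N" for j
    using that vc[OF that] by (auto simp: V_def intro!: eq_vecI)
  have AV: "A * V = V * mat_diag N f"
    unfolding mat_diag_mult_right[OF V]
  proof (rule eq_matI)
    fix i j assume "i < dim_row (mat N N (\<lambda>(i,j). V $$ (i,j) * f j))"
      "j < dim_col (mat N N (\<lambda>(i,j). V $$ (i,j) * f j))"
    then have ij: "i < N" "j < N" by auto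
    have "(A * V) $$ (i,j) = (A *\<^sub>v v j) $ i" using ij A V colV by simp
    also have "\<dots> = f j * v j $ i" using ij vc[of j] by (simp add: Av)
    finally show "(A * V) $$ (i,j) = mat N N (\<lambda>(i,j). V $$ (i,j) * f j) $$ (i,j)"
      using ij by (simp add: V_def)
  qed (use A V in auto)
  define D where "D = mat_diag N f"
  have D: "D \<in> carrier_mat N N" by (simp add: D_def)
  have "det V \<noteq> 0"
  proof
    assume "det V = 0"
    (* D - f i maps the kernel of V into itself and deletes the i-th entry, so a nonzero kernel
       vector of minimal support is a multiple of the i-th unit vector. *)
    define K where "K = {x \<in> carrier_vec N. x \<noteq> 0\<^sub>v N \<and> V *\<^sub>v x = 0\<^sub>v N}"
    define supp where "supp x = {j. j < N \<and> x $ j \<noteq> 0}" for x :: "'a vec"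
    obtain x0 where "x0 \<in> K"
      using \<open>det V = 0\<close> det_0_iff_vec_prod_zero_field[OF V] by (auto simp: K_def)
    from ex_has_least_nat[of "\<lambda>x. x \<in> K", OF this, of "\<lambda>x. card (supp x)"]
    obtain x where xK: "x \<in> K" and xmin: "\<And>y. y \<in> K \<Longrightarrow> card (supp x) \<le> card (supp y)"
      by blast
    have x: "x \<in> carrier_vec N" "x \<noteq> 0\<^sub>v N" "V *\<^sub>v x = 0\<^sub>v N" using xK by (auto simp: K_def)
    obtain i where i: "i < N" "x $ i \<noteq> 0" using x(1,2) by (metis carrier_vecD eq_vecI index_zero_vec)
    define y where "y = D *\<^sub>v x - f i \<cdot>\<^sub>v x"
    have y: "y \<in> carrier_vec N" using D x by (simp add: y_def)
    have yj: "y $ j = (f j - f i) * x $ j" if "j < N" for j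
    proof -
      have "(D *\<^sub>v x) $ j = (\<Sum>k\<in>{0..<N}. (if j = k then f k else 0) * x $ k)"
        using that x(1) by (simp add: D_def mat_diag_def scalar_prod_def)
      also have "\<dots> = (\<Sum>k\<in>{0..<N}. if j = k then f k * x $ k else 0)"
        by (intro sum.cong) auto
      also have "\<dots> = f j * x $ j" using that by simp
      finally show ?thesis using that x(1) D by (simp add: y_def algebra_simps)
    qed
    \<comment> \<open>The kernel of V is invariant under D because V D = A V.\<close>
    have "V *\<^sub>v y = V *\<^sub>v (D *\<^sub>v x) - V *\<^sub>v (f i \<cdot>\<^sub>v x)"
      unfolding y_def using V D x by (intro mult_minus_distrib_mat_vec) auto
    also have "V *\<^sub>v (D *\<^sub>v x) = A *\<^sub>v (V *\<^sub>v x)"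
      using assoc_mult_mat_vec[OF V D x(1)] assoc_mult_mat_vec[OF A V x(1)] AV
      by (simp only: D_def)
    also have "V *\<^sub>v (f i \<cdot>\<^sub>v x) = 0\<^sub>v N"
      unfolding mult_mat_vec[OF V x(1)] x(3) by (rule eq_vecI) auto
    also have "A *\<^sub>v (V *\<^sub>v x) - 0\<^sub>v N = 0\<^sub>v N"
      unfolding x(3) using A by (intro eq_vecI) auto
    finally have Vy: "V *\<^sub>v y = 0\<^sub>v N" .
    have "supp y \<subseteq> supp x"
    proof
      fix j assume "j \<in> supp y"
      then have j: "j < N" "y $ j \<noteq> 0" by (simp_all add: supp_def)
      show "j \<in> supp x" using j(2) unfolding yj[OF j(1)] by (simp add: supp_def j(1))
    qed
    moreover have "i \<in> supp x - supp y"
      using i yj[OF i(1)] by (simp add: supp_def)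
    ultimately have "supp y \<subset> supp x" by (metis DiffE psubsetI)
    then have "card (supp y) < card (supp x)"
      by (intro psubset_card_mono) (auto simp: supp_def)
    then have "y \<notin> K" by (meson xmin leD)
    then have y0: "y = 0\<^sub>v N" using y Vy unfolding K_def by blast
    have xj: "x $ j = 0" if "j < N" "j \<noteq> i" for j
    proof -
      have "f j \<noteq> f i" using inj_onD[OF inj] that i(1) by blast
      then show ?thesis using yj[OF that(1)] that(1) by (simp add: y0)
    qed
    \<comment> \<open>As x is supported at i alone, V x = 0 reads \<open>x $ i\<close> times
      \<open>v i\<close> = 0, which contradicts the choice of a nonzero eigenvector.\<close>
    have "x $ i * v i $ k = 0" if "k < N" for k
    proof -
      have "0 = (V *\<^sub>v x) $ k" using x that by simp
      also have "\<dots> = (\<Sum>j\<in>{0..<N}. V $$ (k,j) * x $ j)"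
        using that x(1) V by (simp add: scalar_prod_def)
      also have "\<dots> = (\<Sum>j\<in>{0..<N}. if j = i then V $$ (k,i) * x $ i else 0)"
        using xj by (intro sum.cong) auto
      also have "\<dots> = V $$ (k,i) * x $ i" using i by simp
      finally show ?thesis using that i by (simp add: V_def)
    qed
    then have "v i = 0\<^sub>v N" using i vc[OF i(1)] by (intro eq_vecI) auto
    then show False using v0 i by simp
  qed
  then show ?thesis using A V AV by (intro similar_matI_intertwiner[of _ N _ V] mat_diag_dim)
qed

text \<open>Since A and F are real, the equation A P = P F splits into its real and imaginary parts,
  so every combination Re P + t Im P with real t is again an intertwiner. It is invertible for all t
  outside a finite set.\<close>

lemma similar_mat_real_of_complex:
  fixes A F :: "real mat"
  assumes A: "A \<in> carrier_mat N N" and F: "F \<in> carrier_mat N N"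
    and sim: "similar_mat (map_mat complex_of_real A) (map_mat complex_of_real F)"
  shows "similar_mat A F"
proof -
  let ?c = "map_mat complex_of_real"
  obtain n P Q where
    *: "{?c A, ?c F, P, Q} \<subseteq> carrier_mat n n" "P * Q = 1\<^sub>m n" "Q * P = 1\<^sub>m n" "?c A = P * ?c F * Q"
    using similar_matD[OF sim] by metis
  have "n = N" using *(1) A by auto
  note * = *[unfolded this]
  have P: "P \<in> carrier_mat N N" and Q: "Q \<in> carrier_mat N N" and F': "?c F \<in> carrier_mat N N"
    using *(1) by auto
  have "?c A * P = P * ?c F * (Q * P)"
    unfolding *(4) using P Q F' by (intro assoc_mult_mat) auto
  then have AP: "?c A * P = P * ?c F" using *(3) P F' by simp
  have "det P * det Q = 1" using det_mult[OF P Q] *(2) by simp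
  then have detP: "det P \<noteq> 0" by auto
  define S where "S t = map_mat Re P + t \<cdot>\<^sub>m map_mat Im P" for t
  have S: "S t \<in> carrier_mat N N" for t using P by (simp add: S_def)
  have inter: "A * S t = S t * F" for t
  proof (rule eq_matI)
    fix i j assume "i < dim_row (S t * F)" "j < dim_col (S t * F)"
    then have ij: "i < N" "j < N" using F P by (auto simp: S_def)
    have e: "(?c A * P) $$ (i,j) = (P * ?c F) $$ (i,j)" by (simp only: AP)
    have r: "(\<Sum>k\<in>{0..<N}. A $$ (i,k) * Re (P $$ (k,j))) = (\<Sum>k\<in>{0..<N}. Re (P $$ (i,k)) * F $$ (k,j))"
      using arg_cong[OF e, of Re] ij A F P by (simp add: scalar_prod_def)
    have s: "(\<Sum>k\<in>{0..<N}. A $$ (i,k) * Im (P $$ (k,j))) = (\<Sum>k\<in>{0..<N}. Im (P $$ (i,k)) * F $$ (k,j))"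
      using arg_cong[OF e, of Im] ij A F P by (simp add: scalar_prod_def)
    have "(A * S t) $$ (i,j) = (\<Sum>k\<in>{0..<N}. A $$ (i,k) * Re (P $$ (k,j)))
        + t * (\<Sum>k\<in>{0..<N}. A $$ (i,k) * Im (P $$ (k,j)))"
      using ij A P by (simp add: S_def scalar_prod_def sum.distrib sum_distrib_left algebra_simps)
    also have "\<dots> = (S t * F) $$ (i,j)"
      unfolding r s
      using ij F P by (simp add: S_def scalar_prod_def sum.distrib sum_distrib_left algebra_simps)
    finally show "(A * S t) $$ (i,j) = (S t * F) $$ (i,j)" .
  qed (use A F P in \<open>auto simp: S_def\<close>)
  \<comment> \<open>The pencil Re P + z Im P is encoded as a matrix of polynomials in z, so that its
    determinant is a polynomial whose value at z is the determinant of the pencil there.\<close>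
  define M where "M = map_mat (\<lambda>z. [:complex_of_real (Re z), complex_of_real (Im z):]) P"
  have evM: "poly (det M) z = det (map_mat (\<lambda>p. poly p z) M)" for z
    by (rule comm_ring_hom.hom_det[OF poly_hom.comm_ring_hom_axioms, symmetric])
  \<comment> \<open>At the imaginary unit the pencil is P itself, hence \<open>det M\<close> is not
    the zero polynomial.\<close>
  have "map_mat (\<lambda>p. poly p \<i>) M = P"
    by (rule eq_matI) (auto simp: M_def complex_eq_iff)
  then have "poly (det M) \<i> \<noteq> 0" using detP by (simp only: evM not_False_eq_True)
  then have "det M \<noteq> 0" by auto
  then have "finite {z. poly (det M) z = 0}" by (rule poly_roots_finite)
  moreover have "infinite (range complex_of_real)"
    using finite_imageD[of complex_of_real UNIV] infinite_UNIV_char_0 by (auto simp: inj_def)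
  ultimately obtain t :: real where t: "poly (det M) (complex_of_real t) \<noteq> 0"
    using infinite_super[of "range complex_of_real" "{z. poly (det M) z = 0}"] by auto
  have "map_mat (\<lambda>p. poly p (complex_of_real t)) M = ?c (S t)"
    using P by (intro eq_matI) (auto simp: M_def S_def)
  then have "complex_of_real (det (S t)) \<noteq> 0"
    using t by (simp only: evM of_real_hom.hom_det not_False_eq_True)
  then show ?thesis using A F S inter by (intro similar_matI_intertwiner[of _ N _ "S t"]) auto
qed

section \<open>Complex spectra of real matrices, counted with multiplicity\<close>

lemma eigenvalue_iff_eigvals_real:
  assumes A: "A \<in> carrier_mat N N"
  shows "eigenvalue (map_mat complex_of_real A) z \<longleftrightarrow> z \<in># eigvals_real A"
proof -
  have A': "map_mat complex_of_real A \<in> carrier_mat N N" using A by simp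
  \<comment> \<open>The characteristic polynomial is monic, hence nonzero, so the members of its
    root multiset are exactly its roots.\<close>
  have "char_poly (map_mat complex_of_real A) \<noteq> 0"
    using degree_monic_char_poly[OF A'] by auto
  then show ?thesis
    by (simp add: eigvals_real_def eigenvalue_root_char_poly[OF A'])
qed

text \<open>The characteristic polynomial has degree N and splits over the complex numbers.\<close>

lemma size_eigvals_real:
  assumes A: "A \<in> carrier_mat N N"
  shows "size (eigvals_real A) = N"
  using degree_monic_char_poly[of "map_mat complex_of_real A" N] A
  by (simp add: eigvals_real_def size_proots_complex)

lemma eigvals_real_similar:
  assumes "similar_mat A F"
  shows "eigvals_real A = eigvals_real F"
proof -
  obtain n where "A \<in> carrier_mat n n" "F \<in> carrier_mat n n" using similar_matD[OF assms] by auto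
  then show ?thesis
    unfolding eigvals_real_def
    by (simp add: of_real_hom.char_poly_hom char_poly_similar[OF assms])
qed

text \<open>Both matrices are similar over the complex numbers to the same diagonal matrix, and this
  similarity descends to the reals.\<close>

lemma similar_mat_of_simple_spectrum:
  assumes A: "A \<in> carrier_mat N N" and F: "F \<in> carrier_mat N N"
    and eq: "eigvals_real A = eigvals_real F"
    and simple: "\<And>z. count (eigvals_real F) z \<le> 1"
  shows "similar_mat A F"
proof -
  \<comment> \<open>An arbitrary enumeration of the common spectrum fixes the order of the diagonal
    entries for A and F alike.\<close>
  obtain zs where zs: "mset zs = eigvals_real F" using ex_mset by blast
  have len: "length zs = N" using size_eigvals_real[OF F] zs by (metis size_mset)
  have "distinct zs"
    unfolding distinct_count_atmost_1
  proof
    fix z show "count (mset zs) z = (if z \<in> set zs then 1 else 0)"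
      using simple[of z] unfolding zs[symmetric] by (cases "z \<in> set zs") (auto simp: le_Suc_eq count_mset_0_iff)
  qed
  then have inj: "inj_on ((!) zs) {..<N}" using len by (auto intro: inj_on_nth)
  have mem: "zs ! i \<in># eigvals_real F" if "i < N" for i
    using that len by (simp flip: zs)
  have "similar_mat (map_mat complex_of_real A) (mat_diag N ((!) zs))"
    using A inj mem eq by (intro similar_mat_diag_of_distinct_eigenvalues) (auto simp: eigenvalue_iff_eigvals_real)
  moreover have "similar_mat (map_mat complex_of_real F) (mat_diag N ((!) zs))"
    using F inj mem by (intro similar_mat_diag_of_distinct_eigenvalues) (auto simp: eigenvalue_iff_eigvals_real)
  ultimately show ?thesis
    using A F by (intro similar_mat_real_of_complex) (auto intro: similar_mat_trans similar_mat_sym)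
qed

section \<open>Realizing a conjugation-symmetric spectrum by a real matrix\<close>

lemma eigvals_real_block_diag:
  assumes A: "A \<in> carrier_mat k k" and F: "F \<in> carrier_mat l l"
  shows "eigvals_real (four_block_mat A (0\<^sub>m k l) (0\<^sub>m l k) F) = eigvals_real A + eigvals_real F"
proof -
  let ?c = "map_mat complex_of_real"
  have A': "?c A \<in> carrier_mat k k" and F': "?c F \<in> carrier_mat l l" using A F by auto
  have "?c (four_block_mat A (0\<^sub>m k l) (0\<^sub>m l k) F) = four_block_mat (?c A) (0\<^sub>m k l) (0\<^sub>m l k) (?c F)"
    using A F by (intro eq_matI) auto
  \<comment> \<open>The block rule is fed the factorizations of both characteristic polynomials into
    linear factors, which exist over the complex numbers.\<close>
  moreover have "char_poly \<dots> = char_poly (?c A) * char_poly (?c F)"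
    using char_poly_factorized[OF A'] char_poly_factorized[OF F'] A' F'
    by (intro char_poly_0_block[OF refl, where n = k and m = l]) auto
  moreover have "char_poly (?c A) \<noteq> 0" "char_poly (?c F) \<noteq> 0"
    using degree_monic_char_poly[OF A'] degree_monic_char_poly[OF F'] by auto
  ultimately show ?thesis
    by (simp add: eigvals_real_def proots_mult)
qed

text \<open>This is the matrix of multiplication by z on the real plane. Both z and its conjugate
  are eigenvalues, and a spectrum of size 2 leaves no room for others.\<close>

lemma eigvals_real_rotation:
  assumes "Im z \<noteq> 0"
  shows "eigvals_real (mat 2 2 (\<lambda>(i,j). if i = j then Re z else if i < j then - Im z else Im z))
    = {#z, cnj z#}" (is "eigvals_real ?R = _")
proof -
  have R: "?R \<in> carrier_mat 2 2" by simp
  have ev: "w \<in># eigvals_real ?R" if w: "w = z \<or> w = cnj z" for w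
  proof -
    \<comment> \<open>The vector is read off from the first row of R - w, which annihilates it for
      every w. The second row does so because the square of Re z - w is minus the square of Im z for
      both choices of w.\<close>
    let ?v = "vec 2 (\<lambda>i. if i = 0 then complex_of_real (Im z) else complex_of_real (Re z) - w)"
    have "map_mat complex_of_real ?R *\<^sub>v ?v = w \<cdot>\<^sub>v ?v"
      using w by (intro eq_vecI) (auto simp: scalar_prod_def less_2_cases_iff numeral_2_eq_2
        complex_eq_iff power2_eq_square algebra_simps)
    moreover have "?v \<noteq> 0\<^sub>v 2" using assms by (auto simp: vec_eq_iff)
    ultimately have "eigenvector (map_mat complex_of_real ?R) ?v w"
      by (simp add: eigenvector_def)
    then show ?thesis using eigenvalue_iff_eigvals_real[OF R] by (auto simp: eigenvalue_def)
  qed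
  \<comment> \<open>Distinctness upgrades membership of the two eigenvalues to inclusion of
    multisets.\<close>
  have "z \<noteq> cnj z" using assms by (auto simp: complex_eq_iff)
  then have sub: "{#z, cnj z#} \<subseteq># eigvals_real ?R"
    using ev by (simp add: insert_subset_eq_iff in_diff_count)
  then have "size (eigvals_real ?R - {#z, cnj z#}) = 0"
    using size_eigvals_real[OF R] by (simp only: size_Diff_submset) simp
  then have "eigvals_real ?R - {#z, cnj z#} = {#}" by (simp only: size_eq_0_iff_empty)
  with subset_mset.diff_add[OF sub] show ?thesis by (simp only: add_0)
qed

lemma ex_real_mat_eigvals:
  assumes "image_mset cnj \<Gamma> = \<Gamma>"
  shows "\<exists>F \<in> carrier_mat (size \<Gamma>) (size \<Gamma>). eigvals_real F = \<Gamma>"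
  using assms
proof (induction "size \<Gamma>" arbitrary: \<Gamma> rule: less_induct)
  case less
  \<comment> \<open>Common to both kinds of block: once a nonempty symmetric part \<Gamma>1 realized
    by R is split off, the rest is symmetric by cancellation, is realized by the induction
    hypothesis, and is joined to R block-diagonally.\<close>
  have step: "\<exists>F \<in> carrier_mat (size \<Gamma>) (size \<Gamma>). eigvals_real F = \<Gamma>"
    if \<Gamma>: "\<Gamma> = \<Gamma>1 + \<Gamma>2" and ne: "\<Gamma>1 \<noteq> {#}" and sym: "image_mset cnj \<Gamma>1 = \<Gamma>1"
      and R: "R \<in> carrier_mat (size \<Gamma>1) (size \<Gamma>1)" "eigvals_real R = \<Gamma>1" for \<Gamma>1 \<Gamma>2 R
  proof -
    have "image_mset cnj \<Gamma>2 = \<Gamma>2" using less.prems sym by (simp add: \<Gamma>)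
    moreover have "size \<Gamma>2 < size \<Gamma>" using ne by (simp add: \<Gamma> nonempty_has_size)
    ultimately obtain F where F: "F \<in> carrier_mat (size \<Gamma>2) (size \<Gamma>2)" "eigvals_real F = \<Gamma>2"
      using less.hyps by blast
    show ?thesis
      using eigvals_real_block_diag[OF R(1) F(1)] R F four_block_carrier_mat[OF R(1) F(1)]
      by (auto simp: \<Gamma>)
  qed
  show ?case
  proof (cases "\<Gamma> = {#}")
    case True
    \<comment> \<open>The empty spectrum belongs to the 0 x 0 matrix.\<close>
    have "1\<^sub>m 0 \<in> carrier_mat 0 (0::nat)" by simp
    from size_eigvals_real[OF this] show ?thesis using True by auto
  next
    case False
    then obtain z where z: "z \<in># \<Gamma>" by auto
    show ?thesis
    proof (cases "Im z = 0")
      case True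
      let ?R = "mat 1 1 (\<lambda>_. Re z)"
      have R: "?R \<in> carrier_mat 1 1" by simp
      have "upper_triangular (map_mat complex_of_real ?R)" by auto
      then have "char_poly (map_mat complex_of_real ?R) = [:- z, 1:]"
        using True by (subst char_poly_upper_triangular[of _ 1]) (auto simp: diag_mat_def complex_eq_iff)
      then have "eigvals_real ?R = {#z#}" by (simp add: eigvals_real_def)
      then show ?thesis
        using z True by (intro step[of "{#z#}" "\<Gamma> - {#z#}" ?R]) (auto simp: complex_eq_iff)
    next
      case False
      have "cnj z \<in># \<Gamma>" using z less.prems by (metis image_eqI set_image_mset)
      moreover have "z \<noteq> cnj z" using False by (auto simp: complex_eq_iff)
      ultimately have sub: "{#z, cnj z#} \<subseteq># \<Gamma>"
        using z by (simp add: insert_subset_eq_iff in_diff_count)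
      show ?thesis
        by (rule step[OF subset_mset.add_diff_inverse[OF sub, symmetric] _ _ _ eigvals_real_rotation[OF False]])
          (auto simp: numeral_2_eq_2)
    qed
  qed
qed

section \<open>Bimatrix algebra through the real representation\<close>

lemma bimat_mult_closed:
  "P \<in> carrier_bimat r k \<Longrightarrow> Q \<in> carrier_bimat k c \<Longrightarrow> bimat_mult P Q \<in> carrier_bimat r c"
  by (auto simp: carrier_bimat_def bimat_mult_def)

lemma bimat_add_closed:
  "P \<in> carrier_bimat r c \<Longrightarrow> Q \<in> carrier_bimat r c \<Longrightarrow> bimat_add P Q \<in> carrier_bimat r c"
  by (auto simp: carrier_bimat_def bimat_add_def)

lemma bimat_one_closed: "bimat_one n \<in> carrier_bimat n n"
  by (simp add: carrier_bimat_def bimat_one_def)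

lemma real_rep_closed:
  "P \<in> carrier_bimat r c \<Longrightarrow> real_rep P \<in> carrier_mat (2 * r) (2 * c)"
  by (auto simp: carrier_bimat_def real_rep_def)

lemma real_rep_index:
  assumes "P \<in> carrier_bimat r c" "i < r" "j < c"
  shows "real_rep P $$ (i, j) = Re (fst P $$ (i, j)) + Re (snd P $$ (i, j))"
    and "real_rep P $$ (i, j + c) = - Im (fst P $$ (i, j)) - Im (snd P $$ (i, j))"
    and "real_rep P $$ (i + r, j) = Im (fst P $$ (i, j)) - Im (snd P $$ (i, j))"
    and "real_rep P $$ (i + r, j + c) = Re (fst P $$ (i, j)) - Re (snd P $$ (i, j))"
  using assms by (auto simp: carrier_bimat_def real_rep_def)

text \<open>The blocks carry sums and differences of the real and imaginary parts of the two
  components, from which both are recovered. Rectangular shapes are covered because gains are m x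
  n.\<close>

lemma real_rep_inject:
  assumes P: "P \<in> carrier_bimat r c" and Q: "Q \<in> carrier_bimat r c"
    and eq: "real_rep P = real_rep Q"
  shows "P = Q"
proof -
  have "fst P $$ (i, j) = fst Q $$ (i, j) \<and> snd P $$ (i, j) = snd Q $$ (i, j)"
    if "i < r" "j < c" for i j
    using real_rep_index[OF P that] real_rep_index[OF Q that]
    unfolding eq complex_eq_iff by linarith
  then show ?thesis
    using P Q by (auto simp: carrier_bimat_def prod_eq_iff intro!: eq_matI)
qed

lemma real_rep_add:
  assumes "P \<in> carrier_bimat r c" "Q \<in> carrier_bimat r c"
  shows "real_rep (bimat_add P Q) = real_rep P + real_rep Q"
  by (rule eq_matI) (use assms in \<open>auto simp: carrier_bimat_def real_rep_def bimat_add_def\<close>)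

text \<open>\<open>real_rep\<close> gives the matrix of the associated real-linear map in the
  coordinates (Re x, Im x), so composition becomes matrix multiplication. The proof compares the
  four blocks entrywise.\<close>

lemma real_rep_mult:
  assumes P: "P \<in> carrier_bimat r k" and Q: "Q \<in> carrier_bimat k c"
  shows "real_rep (bimat_mult P Q) = real_rep P * real_rep Q"
proof -
  obtain P1 P2 Q1 Q2 where PQ: "P = (P1, P2)" "Q = (Q1, Q2)" by (metis surj_pair)
  have c: "P1 \<in> carrier_mat r k" "P2 \<in> carrier_mat r k"
    "Q1 \<in> carrier_mat k c" "Q2 \<in> carrier_mat k c"
    using P Q by (auto simp: PQ carrier_bimat_def)
  show ?thesis
    unfolding real_rep_def bimat_mult_def PQ fst_conv snd_conv
    by (subst mult_four_block_mat[of _ r k _ k _ r _ _ c _ c];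
        (intro cong_four_block_mat eq_matI)?;
        use c in \<open>auto simp: scalar_prod_def sum.distrib sum_subtractf sum_negf algebra_simps\<close>)
qed

lemma real_rep_one: "real_rep (bimat_one n) = 1\<^sub>m (2 * n)"
  by (rule eq_matI) (auto simp: real_rep_def bimat_one_def)

lemma bimat_of_real:
  assumes "F \<in> carrier_mat (2 * n) (2 * n)"
  shows "bimat_of_real n F \<in> carrier_bimat n n" and "real_rep (bimat_of_real n F) = F"
  using theI'[OF ex1_real_rep[OF assms]] by (auto simp: bimat_of_real_def)

text \<open>Pulled back from associativity of real matrix multiplication along the injection
  \<open>real_rep\<close>.\<close>

lemma bimat_mult_assoc:
  assumes "P \<in> carrier_bimat r k" "Q \<in> carrier_bimat k l" "R \<in> carrier_bimat l c"
  shows "bimat_mult (bimat_mult P Q) R = bimat_mult P (bimat_mult Q R)"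
  using assms
  by (intro real_rep_inject[of _ r c])
    (auto simp: bimat_mult_closed real_rep_mult[of _ r l _ c] real_rep_mult[of _ r k _ l]
      real_rep_mult[of _ r k _ c] real_rep_mult[of _ k l _ c]
      intro!: assoc_mult_mat real_rep_closed bimat_mult_closed)

lemma bimat_mult_one:
  assumes "P \<in> carrier_bimat r c"
  shows "bimat_mult P (bimat_one c) = P" and "bimat_mult (bimat_one r) P = P"
  using assms real_rep_closed[OF assms]
  by (auto intro!: real_rep_inject[of _ r c] bimat_mult_closed bimat_one_closed
      simp: real_rep_mult[OF assms bimat_one_closed] real_rep_mult[OF bimat_one_closed assms] real_rep_one)

lemma is_bimat_inv_iff_real_rep:
  assumes X: "X \<in> carrier_bimat n n" and Z: "Z \<in> carrier_bimat n n"
  shows "is_bimat_inv n X Z \<longleftrightarrow>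
    real_rep X * real_rep Z = 1\<^sub>m (2 * n) \<and> real_rep Z * real_rep X = 1\<^sub>m (2 * n)"
  using X Z unfolding is_bimat_inv_def
  by (metis bimat_mult_closed bimat_one_closed real_rep_inject real_rep_mult real_rep_one)

text \<open>Two-sided inverses are unique by the usual computation W = (W X) Z = Z, so the definite
  description in \<open>bimat_inv\<close> denotes.\<close>

lemma bimat_inv:
  assumes "nonsingular_bimat n X"
  shows "is_bimat_inv n X (bimat_inv n X)"
proof -
  obtain Z where X: "X \<in> carrier_bimat n n" and Z: "is_bimat_inv n X Z"
    using assms by (auto simp: nonsingular_bimat_def)
  have "W = Z" if W: "is_bimat_inv n X W" for W
  proof -
    have "W = bimat_mult (bimat_mult W X) Z"
      using W Z X bimat_mult_assoc[of W n n X n Z n] bimat_mult_one[of W n n]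
      by (simp add: is_bimat_inv_def)
    also have "\<dots> = Z" using W Z bimat_mult_one[of Z n n] by (simp add: is_bimat_inv_def)
    finally show ?thesis .
  qed
  then show ?thesis using Z unfolding bimat_inv_def by (metis theI)
qed

section \<open>The closed loop, similarity and the Sylvester equation\<close>

lemma closed_loop_closed:
  "A \<in> carrier_bimat n n \<Longrightarrow> B \<in> carrier_bimat n m \<Longrightarrow> K \<in> carrier_bimat m n \<Longrightarrow>
    closed_loop A B K \<in> carrier_bimat n n"
  unfolding closed_loop_def by (blast intro: bimat_add_closed bimat_mult_closed)

text \<open>Under the substitution Y = K X the left side of the Sylvester equation becomes the
  closed loop times X. Distributivity is taken from real matrices, associativity from
  bimatrices.\<close>

lemma bimat_mult_closed_loop:
  assumes A: "A \<in> carrier_bimat n n" and B: "B \<in> carrier_bimat n m"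
    and K: "K \<in> carrier_bimat m n" and X: "X \<in> carrier_bimat n n"
  shows "bimat_mult (closed_loop A B K) X =
    bimat_add (bimat_mult A X) (bimat_mult B (bimat_mult K X))"
proof -
  note cl = bimat_mult_closed bimat_add_closed real_rep_closed
  have "bimat_mult (closed_loop A B K) X =
      bimat_add (bimat_mult A X) (bimat_mult (bimat_mult B K) X)"
    unfolding closed_loop_def
  proof (rule real_rep_inject)
    have "real_rep (bimat_mult (bimat_add A (bimat_mult B K)) X) =
        (real_rep A + real_rep (bimat_mult B K)) * real_rep X"
      using A B K X by (simp add: real_rep_mult[of _ n n _ n] real_rep_add[of _ n n] cl[of _ n m] cl)
    also have "\<dots> = real_rep A * real_rep X + real_rep (bimat_mult B K) * real_rep X"
      using A B K X by (intro add_mult_distrib_mat[of _ "2*n" "2*n" _ _ "2*n"] cl)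
    also have "\<dots> = real_rep (bimat_add (bimat_mult A X) (bimat_mult (bimat_mult B K) X))"
      using A X bimat_mult_closed[OF B K]
      by (simp add: real_rep_mult[of _ n n _ n] real_rep_add[of _ n n] cl)
    finally show "real_rep (bimat_mult (bimat_add A (bimat_mult B K)) X) =
        real_rep (bimat_add (bimat_mult A X) (bimat_mult (bimat_mult B K) X))" .
  qed (use A B K X in \<open>blast intro: cl\<close>)+
  then show ?thesis by (simp add: bimat_mult_assoc[OF B K X])
qed

text \<open>Since \<open>real_rep\<close> maps n x n bimatrices bijectively and multiplicatively
  onto real 2n x 2n matrices, a matrix performing the similarity is the same thing as a nonsingular
  bimatrix X with C X = X {F1, F2}.\<close>

lemma similar_mat_real_rep_iff:
  assumes C: "C \<in> carrier_bimat n n" and F: "F \<in> carrier_mat (2 * n) (2 * n)"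
  shows "similar_mat (real_rep C) F \<longleftrightarrow>
    (\<exists>X. nonsingular_bimat n X \<and> bimat_mult C X = bimat_mult X (bimat_of_real n F))"
proof
  assume "similar_mat (real_rep C) F"
  then obtain N P Q where *: "{real_rep C, F, P, Q} \<subseteq> carrier_mat N N"
    "P * Q = 1\<^sub>m N" "Q * P = 1\<^sub>m N" "real_rep C = P * F * Q"
    by (blast dest: similar_matD)
  have "N = 2 * n" using * F by auto
  note * = *[unfolded this]
  \<comment> \<open>Surjectivity of \<open>real_rep\<close> turns the transforming matrix and its
    inverse into bimatrices.\<close>
  define X Z where "X = bimat_of_real n P" and "Z = bimat_of_real n Q"
  have X: "X \<in> carrier_bimat n n" "real_rep X = P" and Z: "Z \<in> carrier_bimat n n" "real_rep Z = Q"
    using * by (auto simp: X_def Z_def bimat_of_real)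
  have "nonsingular_bimat n X"
    using X Z * is_bimat_inv_iff_real_rep[OF X(1) Z(1)] unfolding nonsingular_bimat_def by blast
  moreover have "bimat_mult C X = bimat_mult X (bimat_of_real n F)"
  proof (rule real_rep_inject)
    have "real_rep C * P = P * F * (Q * P)"
      unfolding *(4) using * F by (intro assoc_mult_mat) auto
    then show "real_rep (bimat_mult C X) = real_rep (bimat_mult X (bimat_of_real n F))"
      using * X C F by (simp add: real_rep_mult[of _ n n _ n] bimat_of_real)
  qed (use C X F in \<open>auto intro: bimat_mult_closed bimat_of_real\<close>)
  ultimately show "\<exists>X. nonsingular_bimat n X \<and> bimat_mult C X = bimat_mult X (bimat_of_real n F)"
    by blast
next
  assume "\<exists>X. nonsingular_bimat n X \<and> bimat_mult C X = bimat_mult X (bimat_of_real n F)"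
  then obtain X where X: "nonsingular_bimat n X" "X \<in> carrier_bimat n n"
    and eq: "bimat_mult C X = bimat_mult X (bimat_of_real n F)"
    by (auto simp: nonsingular_bimat_def)
  define Z where "Z = bimat_inv n X"
  have inv: "is_bimat_inv n X Z" and Z: "Z \<in> carrier_bimat n n"
    using bimat_inv[OF X(1)] by (auto simp: Z_def is_bimat_inv_def)
  have inv': "real_rep X * real_rep Z = 1\<^sub>m (2 * n)" "real_rep Z * real_rep X = 1\<^sub>m (2 * n)"
    using inv is_bimat_inv_iff_real_rep[OF X(2) Z] by auto
  have "real_rep C = real_rep C * (real_rep X * real_rep Z)"
    using inv' real_rep_closed[OF C] by simp
  also have "\<dots> = real_rep C * real_rep X * real_rep Z"
    using assoc_mult_mat[OF real_rep_closed[OF C] real_rep_closed[OF X(2)] real_rep_closed[OF Z]] by simp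
  also have "real_rep C * real_rep X = real_rep X * F"
    using arg_cong[OF eq, of real_rep] C X F by (simp add: real_rep_mult[of _ n n _ n] bimat_of_real)
  finally show "similar_mat (real_rep C) F"
    using inv' F real_rep_closed[OF C] real_rep_closed[OF X(2)] real_rep_closed[OF Z]
    by (intro similar_matI[of _ _ "real_rep X" "real_rep Z" "2 * n"]) auto
qed

text \<open>For a fixed nonsingular X the substitutions Y = K X and K = Y X^-1 undo each other, and
  the Sylvester equation then says that X intertwines the closed loop with F. Which gains arise is
  thus decided by similarity to F, not merely by the spectrum.\<close>

lemma sylvester_gain_iff_similar:
  assumes A: "A \<in> carrier_bimat n n" and B: "B \<in> carrier_bimat n m"
    and F: "F \<in> carrier_mat (2 * n) (2 * n)"
  shows "(\<exists>X Y. nonsingular_sylvester_solution n m A B F X Y \<and> K = bimat_mult Y (bimat_inv n X)) \<longleftrightarrow>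
    K \<in> carrier_bimat m n \<and> similar_mat (real_rep (closed_loop A B K)) F"
proof safe
  fix X Y assume sol: "nonsingular_sylvester_solution n m A B F X Y"
  define Z where "Z = bimat_inv n X"
  have ns: "nonsingular_bimat n X" and X: "X \<in> carrier_bimat n n" and Y: "Y \<in> carrier_bimat m n"
    using sol by (auto simp: nonsingular_sylvester_solution_def nonsingular_bimat_def)
  have Z: "Z \<in> carrier_bimat n n" "bimat_mult Z X = bimat_one n"
    using bimat_inv[OF ns] by (auto simp: Z_def is_bimat_inv_def)
  show K: "bimat_mult Y (bimat_inv n X) \<in> carrier_bimat m n"
    using bimat_mult_closed[OF Y Z(1)] by (simp add: Z_def)
  have "bimat_mult (bimat_mult Y (bimat_inv n X)) X = Y"
    using bimat_mult_assoc[OF Y Z(1) X] bimat_mult_one[OF Y] Z by (simp add: Z_def)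
  then have "bimat_mult (closed_loop A B (bimat_mult Y (bimat_inv n X))) X = bimat_mult X (bimat_of_real n F)"
    using sol bimat_mult_closed_loop[OF A B K X] by (simp add: nonsingular_sylvester_solution_def)
  then show "similar_mat (real_rep (closed_loop A B (bimat_mult Y (bimat_inv n X)))) F"
    using ns similar_mat_real_rep_iff[OF closed_loop_closed[OF A B K] F] by blast
next
  assume K: "K \<in> carrier_bimat m n" and sim: "similar_mat (real_rep (closed_loop A B K)) F"
  from sim obtain X where ns: "nonsingular_bimat n X"
    and eq: "bimat_mult (closed_loop A B K) X = bimat_mult X (bimat_of_real n F)"
    using similar_mat_real_rep_iff[OF closed_loop_closed[OF A B K] F] by blast
  have X: "X \<in> carrier_bimat n n" using ns by (simp add: nonsingular_bimat_def)
  have Z: "bimat_inv n X \<in> carrier_bimat n n" "bimat_mult X (bimat_inv n X) = bimat_one n"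
    using bimat_inv[OF ns] by (auto simp: is_bimat_inv_def)
  have "K = bimat_mult (bimat_mult K X) (bimat_inv n X)"
    using bimat_mult_assoc[OF K X Z(1)] bimat_mult_one[OF K] Z(2) by simp
  moreover have "nonsingular_sylvester_solution n m A B F X (bimat_mult K X)"
    using ns eq bimat_mult_closed_loop[OF A B K X] bimat_mult_closed[OF K X]
    by (simp add: nonsingular_sylvester_solution_def)
  ultimately show "\<exists>X Y. nonsingular_sylvester_solution n m A B F X Y \<and>
      K = bimat_mult Y (bimat_inv n X)"
    by blast
qed

text \<open>The first equivalence quantifies F existentially because a repeated eigenvalue does not
  fix the similarity class. For n = 1, A the identity, B zero and \<Gamma> twice the number 1, every
  K of the right size solves the problem, yet a nonsingular X forces F to be the identity and so
  rules out a nontrivial Jordan block. For a prescribed F the exact criterion adds similarity to F,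
  which a simple spectrum makes automatic.\<close>

theorem lemma1:
  fixes n m :: nat and A B :: bimat and \<Gamma> :: "complex multiset"
  assumes "A \<in> carrier_bimat n n"
    and "B \<in> carrier_bimat n m"
    and "size \<Gamma> = 2 * n"
    and "image_mset cnj \<Gamma> = \<Gamma>"
  shows "(\<exists>F \<in> carrier_mat (2 * n) (2 * n). eigvals_real F = \<Gamma>) \<and>
    (pole_assignment_solvable n m A B \<Gamma> \<longleftrightarrow>
       (\<exists>F \<in> carrier_mat (2 * n) (2 * n). eigvals_real F = \<Gamma> \<and>
          (\<exists>X Y. nonsingular_sylvester_solution n m A B F X Y))) \<and>
    (\<forall>F \<in> carrier_mat (2 * n) (2 * n). eigvals_real F = \<Gamma> \<longrightarrow>
       (\<forall>X Y. nonsingular_sylvester_solution n m A B F X Y \<longrightarrow>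
          solves_pole_assignment n m A B \<Gamma> (bimat_mult Y (bimat_inv n X))) \<and>
       (\<forall>K. solves_pole_assignment n m A B \<Gamma> K \<and> similar_mat (real_rep (closed_loop A B K)) F \<longleftrightarrow>
          (\<exists>X Y. nonsingular_sylvester_solution n m A B F X Y \<and>
             K = bimat_mult Y (bimat_inv n X))) \<and>
       ((\<forall>\<gamma>. count \<Gamma> \<gamma> \<le> 1) \<longrightarrow>
          (pole_assignment_solvable n m A B \<Gamma> \<longleftrightarrow>
             (\<exists>X Y. nonsingular_sylvester_solution n m A B F X Y)) \<and>
          (\<forall>K. solves_pole_assignment n m A B \<Gamma> K \<longleftrightarrow>
             (\<exists>X Y. nonsingular_sylvester_solution n m A B F X Y \<and>
                K = bimat_mult Y (bimat_inv n X)))))"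
proof (intro conjI ballI impI)
  note A = assms(1) and B = assms(2)
  show "\<exists>F \<in> carrier_mat (2 * n) (2 * n). eigvals_real F = \<Gamma>"
    using ex_real_mat_eigvals[OF assms(4)] assms(3) by simp
  have gain: "(\<exists>X Y. nonsingular_sylvester_solution n m A B F X Y \<and> K = bimat_mult Y (bimat_inv n X)) \<longleftrightarrow>
      K \<in> carrier_bimat m n \<and> similar_mat (real_rep (closed_loop A B K)) F"
    if "F \<in> carrier_mat (2 * n) (2 * n)" for F K
    by (rule sylvester_gain_iff_similar[OF A B that])
  have solves: "solves_pole_assignment n m A B \<Gamma> K"
    if "K \<in> carrier_bimat m n" "similar_mat (real_rep (closed_loop A B K)) F" "eigvals_real F = \<Gamma>" for F K
    using that eigvals_real_similar by (simp add: solves_pole_assignment_def bimat_eigvals_def)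
  have cl: "real_rep (closed_loop A B K) \<in> carrier_mat (2 * n) (2 * n)"
    "eigvals_real (real_rep (closed_loop A B K)) = \<Gamma>" "K \<in> carrier_bimat m n"
    if "solves_pole_assignment n m A B \<Gamma> K" for K
    using that by (auto simp: solves_pole_assignment_def bimat_eigvals_def
        intro: real_rep_closed closed_loop_closed[OF A B])
  \<comment> \<open>From left to right the witness for F is the real representation of the closed
    loop, similar to itself.\<close>
  show "pole_assignment_solvable n m A B \<Gamma> \<longleftrightarrow>
      (\<exists>F \<in> carrier_mat (2 * n) (2 * n). eigvals_real F = \<Gamma> \<and>
        (\<exists>X Y. nonsingular_sylvester_solution n m A B F X Y))"
    unfolding pole_assignment_solvable_def
    using gain solves cl similar_mat_refl by metis
  fix F :: "real mat"
  assume F: "F \<in> carrier_mat (2 * n) (2 * n)" and \<Gamma>: "eigvals_real F = \<Gamma>"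
  show "\<forall>X Y. nonsingular_sylvester_solution n m A B F X Y \<longrightarrow>
      solves_pole_assignment n m A B \<Gamma> (bimat_mult Y (bimat_inv n X))"
    using gain[OF F] solves \<Gamma> by blast
  show all: "\<forall>K. solves_pole_assignment n m A B \<Gamma> K \<and> similar_mat (real_rep (closed_loop A B K)) F \<longleftrightarrow>
      (\<exists>X Y. nonsingular_sylvester_solution n m A B F X Y \<and> K = bimat_mult Y (bimat_inv n X))"
    using gain[OF F] solves \<Gamma> cl(3) by blast
  assume simple: "\<forall>\<gamma>. count \<Gamma> \<gamma> \<le> 1"
  \<comment> \<open>With a simple spectrum the similarity conjunct in \<open>all\<close> follows
    from equality of spectra.\<close>
  have "similar_mat (real_rep (closed_loop A B K)) F" if "solves_pole_assignment n m A B \<Gamma> K" for K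
    using cl[OF that] F \<Gamma> simple by (intro similar_mat_of_simple_spectrum[of _ "2 * n"]) auto
  then show iff: "\<forall>K. solves_pole_assignment n m A B \<Gamma> K \<longleftrightarrow>
      (\<exists>X Y. nonsingular_sylvester_solution n m A B F X Y \<and> K = bimat_mult Y (bimat_inv n X))"
    using all by blast
  show "pole_assignment_solvable n m A B \<Gamma> \<longleftrightarrow>
      (\<exists>X Y. nonsingular_sylvester_solution n m A B F X Y)"
    unfolding pole_assignment_solvable_def using iff by blast
qed

end
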